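(* Let $F:A\times B\to Z$ be a single-valued mapping. Suppose that $F$ is partially Gâteaux differentiable with respect to each variable in $A\times B$. If $F$ is order-increasing (respectively, order-decreasing) in $B$ with respect to the second variable at some point $\bar x\in A$, then for any given $w\in B$, $$\partial_2F(\bar x,w)(u)\succcurlyeq_M\theta_Z\ (\text{respectively, }\preccurlyeq_M\theta_Z)\quad\text{for any } u\in K\setminus\{\theta_Y\}.$$ In particular, if $F$ is partially Fréchet differentiable with respect to each variable in $A\times B$ and $F$ is order-increasing (respectively, order-decreasing) in $B$ with respect to the second variable at some point $\bar x\in A$, then for any given $w\in B$, $$\nabla_2F(\bar x,w)(u)\succcurlyeq_M\theta_Z\ (\text{respectively, }\preccurlyeq_M\theta_Z)\quad\text{for any } u\in K\setminus\{\theta_Y\}.$$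
   Context: $(X,\|\cdot\|_X,\preccurlyeq_C)$, $(Y,\|\cdot\|_Y,\preccurlyeq_K)$, $(Z,\|\cdot\|_Z,\preccurlyeq_M)$ are partially ordered Banach spaces whose orders are generated by nonempty closed convex pointed cones $C\subseteq X$, $K\subseteq Y$, $M\subseteq Z$ (e.g. $y\preccurlyeq_Ku$ iff $u-y\in K$); null elements are $\theta_X,\theta_Y,\theta_Z$. $A\subseteq X$, $B\subseteq Y$ are nonempty convex open subsets. $F$ is order-increasing (order-decreasing) in $B$ with respect to the second variable at $\bar x\in A$ if for all $y,u\in B$, $y\preccurlyeq_Ku$ implies $F(\bar x,y)\preccurlyeq_MF(\bar x,u)$ (respectively $F(\bar x,u)\preccurlyeq_MF(\bar x,y)$). Partial Gâteaux differentiability with respect to the first (second) variable at $(\bar x,\bar y)$ means that $\partial_1F(\bar x,\bar y)(v)=\lim_{t\to0}\frac{F(\bar x+tv,\bar y)-F(\bar x,\bar y)}{t}$ exists for every $v\in X\setminus\{\theta_X\}$ ($\partial_2F(\bar x,\bar y)(u)=\lim_{t\to0}\frac{F(\bar x,\bar y+tu)-F(\bar x,\bar y)}{t}$ exists for every $u\in Y\setminus\{\theta_Y\}$), $t$ real. Partial Fréchet differentiability means that there is a continuous linear $\nabla_1F(\bar x,\bar y):X\to Z$ with $\lim_{u\to\theta_X}\frac{F(\bar x+u,\bar y)-F(\bar x,\bar y)-\nabla_1F(\bar x,\bar y)(u)}{\|u\|_X}=\theta_Z$ (a continuous linear $\nabla_2F(\bar x,\bar y):Y\to Z$ with $\lim_{w\to\theta_Y}\frac{F(\bar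 x,\bar y+w)-F(\bar x,\bar y)-\nabla_2F(\bar x,\bar y)(w)}{\|w\|_Y}=\theta_Z$). *)

theory Defs
  imports "HOL-Analysis.Analysis"
begin

definition pointed_closed_convex_cone :: "'a::real_normed_vector set \<Rightarrow> bool" where
  "pointed_closed_convex_cone K \<longleftrightarrow>
     K \<noteq> {} \<and> closed K \<and> convex K \<and> cone K \<and> K \<inter> uminus ` K = {0}"

definition cone_le :: "'a::real_vector \<Rightarrow> 'a set \<Rightarrow> 'a \<Rightarrow> bool"
    ("(_ \<preceq>\<^bsub>_\<^esub> _)" [51, 0, 51] 50) where
  "y \<preceq>\<^bsub>K\<^esub> u \<longleftrightarrow> u - y \<in> K"

definition order_increasing_snd ::
    "'b::real_vector set \<Rightarrow> 'c::real_vector set \<Rightarrow> 'b set \<Rightarrow> ('a \<times> 'b \<Rightarrow> 'c) \<Rightarrow> 'a \<Rightarrow> bool" where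
  "order_increasing_snd K M B F x \<longleftrightarrow>
     (\<forall>y\<in>B. \<forall>u\<in>B. y \<preceq>\<^bsub>K\<^esub> u \<longrightarrow> F (x, y) \<preceq>\<^bsub>M\<^esub> F (x, u))"

definition order_decreasing_snd ::
    "'b::real_vector set \<Rightarrow> 'c::real_vector set \<Rightarrow> 'b set \<Rightarrow> ('a \<times> 'b \<Rightarrow> 'c) \<Rightarrow> 'a \<Rightarrow> bool" where
  "order_decreasing_snd K M B F x \<longleftrightarrow>
     (\<forall>y\<in>B. \<forall>u\<in>B. y \<preceq>\<^bsub>K\<^esub> u \<longrightarrow> F (x, u) \<preceq>\<^bsub>M\<^esub> F (x, y))"

text \<open>
  A map on \<open>A \<times> B\<close> is represented by a total function. The derivatives below are only
  taken at points of \<open>A \<times> B\<close>, and \<open>A\<close>, \<open>B\<close> are open there, so they do not depend on the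
  values outside \<open>A \<times> B\<close>.

  Gateaux differentiability only asks for the directional limits to exist; the map
  \<open>v \<mapsto> \<partial>\<^sub>1F(x,y)(v)\<close> is not required to be linear or continuous.
\<close>

definition gateaux_differentiable_fst ::
    "('a::real_normed_vector \<times> 'b::real_normed_vector \<Rightarrow> 'c::real_normed_vector) \<Rightarrow> 'a \<Rightarrow> 'b \<Rightarrow> bool" where
  "gateaux_differentiable_fst F x y \<longleftrightarrow>
     (\<forall>v. v \<noteq> 0 \<longrightarrow>
        (\<exists>l. ((\<lambda>t::real. (F (x + t *\<^sub>R v, y) - F (x, y)) /\<^sub>R t) \<longlongrightarrow> l) (at 0)))"

definition gateaux_differentiable_snd ::
    "('a::real_normed_vector \<times> 'b::real_normed_vector \<Rightarrow> 'c::real_normed_vector) \<Rightarrow> 'a \<Rightarrow> 'b \<Rightarrow> bool" where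
  "gateaux_differentiable_snd F x y \<longleftrightarrow>
     (\<forall>u. u \<noteq> 0 \<longrightarrow>
        (\<exists>l. ((\<lambda>t::real. (F (x, y + t *\<^sub>R u) - F (x, y)) /\<^sub>R t) \<longlongrightarrow> l) (at 0)))"

definition gateaux_deriv_snd ::
    "('a::real_normed_vector \<times> 'b::real_normed_vector \<Rightarrow> 'c::real_normed_vector) \<Rightarrow> 'a \<Rightarrow> 'b \<Rightarrow> 'b \<Rightarrow> 'c" where
  "gateaux_deriv_snd F x y u =
     Lim (at 0) (\<lambda>t::real. (F (x, y + t *\<^sub>R u) - F (x, y)) /\<^sub>R t)"

definition frechet_differentiable_fst ::
    "('a::real_normed_vector \<times> 'b::real_normed_vector \<Rightarrow> 'c::real_normed_vector) \<Rightarrow> 'a \<Rightarrow> 'b \<Rightarrow> bool" where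
  "frechet_differentiable_fst F x y \<longleftrightarrow> (\<lambda>x'. F (x', y)) differentiable (at x)"

definition frechet_differentiable_snd ::
    "('a::real_normed_vector \<times> 'b::real_normed_vector \<Rightarrow> 'c::real_normed_vector) \<Rightarrow> 'a \<Rightarrow> 'b \<Rightarrow> bool" where
  "frechet_differentiable_snd F x y \<longleftrightarrow> (\<lambda>y'. F (x, y')) differentiable (at y)"

definition frechet_deriv_snd ::
    "('a::real_normed_vector \<times> 'b::real_normed_vector \<Rightarrow> 'c::real_normed_vector) \<Rightarrow> 'a \<Rightarrow> 'b \<Rightarrow> 'b \<Rightarrow> 'c" where
  "frechet_deriv_snd F x y = frechet_derivative (\<lambda>y'. F (x, y')) (at y)"

end

theory Submission
  imports Defs
begin

text \<open>
  For \<open>u \<in> K\<close> and \<open>t > 0\<close> the point \<open>w + t u\<close> lies above \<open>w\<close>, and it stays in the open set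
  \<open>B\<close> for small \<open>t\<close>. If \<open>F(x, \<cdot>)\<close> is increasing, the increment \<open>F(x, w + t u) - F(x, w)\<close> is
  therefore in \<open>M\<close>, and so is the difference quotient, because a cone is stable under the
  positive factor \<open>1/t\<close>. As \<open>M\<close> is closed, the limit of the quotients from the right lies in
  \<open>M\<close>; it is the directional derivative (\<open>directional_derivative_mem_cone\<close>). The decreasing
  case is the increasing one for \<open>-F\<close>, and a Frechet derivative is evaluated along \<open>u\<close> as the
  same limit (\<open>frechet_derivative_directional_limit\<close>).
\<close>

lemma directional_derivative_mem_cone:
  fixes f :: "'b::real_normed_vector \<Rightarrow> 'c::real_normed_vector"
  assumes "cone K" "cone M" "closed M" "open B" "w \<in> B" "u \<in> K"
    and incr: "\<And>y v. \<lbrakk>y \<in> B; v \<in> B; v - y \<in> K\<rbrakk> \<Longrightarrow> f v - f y \<in> M"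
    and lim: "((\<lambda>t::real. (f (w + t *\<^sub>R u) - f w) /\<^sub>R t) \<longlongrightarrow> l) (at 0)"
  shows "l \<in> M"
proof -
  have "((\<lambda>t::real. w + t *\<^sub>R u) \<longlongrightarrow> w + 0 *\<^sub>R u) (at_right 0)"
    by (intro tendsto_intros)
  then have "\<forall>\<^sub>F t::real in at_right 0. w + t *\<^sub>R u \<in> B"
    using \<open>open B\<close> \<open>w \<in> B\<close> by (auto dest: topological_tendstoD)
  moreover have "\<forall>\<^sub>F t::real in at_right 0. t > 0"
    by (rule eventually_at_right_less)
  ultimately have "\<forall>\<^sub>F t in at_right 0. (f (w + t *\<^sub>R u) - f w) /\<^sub>R t \<in> M"
  proof eventually_elim
    case (elim t)
    have "t *\<^sub>R u \<in> K"
      using \<open>cone K\<close> \<open>u \<in> K\<close> elim by (simp add: cone_def)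
    then have "f (w + t *\<^sub>R u) - f w \<in> M"
      using incr[OF \<open>w \<in> B\<close>, of "w + t *\<^sub>R u"] elim by simp
    then show ?case
      using \<open>cone M\<close> elim by (simp add: cone_def)
  qed
  moreover have "((\<lambda>t. (f (w + t *\<^sub>R u) - f w) /\<^sub>R t) \<longlongrightarrow> l) (at_right 0)"
    using lim by (rule filterlim_mono) (simp_all add: at_le)
  ultimately show ?thesis
    using \<open>closed M\<close> by (intro Lim_in_closed_set[where F = "at_right (0::real)"]) auto
qed

lemma directional_derivative_neg_mem_cone:
  fixes f :: "'b::real_normed_vector \<Rightarrow> 'c::real_normed_vector"
  assumes "cone K" "cone M" "closed M" "open B" "w \<in> B" "u \<in> K"
    and decr: "\<And>y v. \<lbrakk>y \<in> B; v \<in> B; v - y \<in> K\<rbrakk> \<Longrightarrow> f y - f v \<in> M"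
    and lim: "((\<lambda>t::real. (f (w + t *\<^sub>R u) - f w) /\<^sub>R t) \<longlongrightarrow> l) (at 0)"
  shows "- l \<in> M"
proof (rule directional_derivative_mem_cone[where f = "\<lambda>y. - f y", OF assms(1-6)])
  show "- f v - - f y \<in> M" if "y \<in> B" "v \<in> B" "v - y \<in> K" for y v
    using decr[OF that] by simp
  have "(- f (w + t *\<^sub>R u) - - f w) /\<^sub>R t = - ((f (w + t *\<^sub>R u) - f w) /\<^sub>R t)" for t :: real
    by (simp add: scaleR_diff_right)
  then show "((\<lambda>t::real. (- f (w + t *\<^sub>R u) - - f w) /\<^sub>R t) \<longlongrightarrow> - l) (at 0)"
    using tendsto_minus[OF lim] by simp
qed

lemma gateaux_deriv_snd_limit:
  assumes "gateaux_differentiable_snd F x w" "u \<noteq> 0"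
  shows "((\<lambda>t::real. (F (x, w + t *\<^sub>R u) - F (x, w)) /\<^sub>R t)
           \<longlongrightarrow> gateaux_deriv_snd F x w u) (at 0)"
proof -
  obtain l where l: "((\<lambda>t::real. (F (x, w + t *\<^sub>R u) - F (x, w)) /\<^sub>R t) \<longlongrightarrow> l) (at 0)"
    using assms by (auto simp: gateaux_differentiable_snd_def)
  with tendsto_Lim[OF trivial_limit_at l] show ?thesis
    by (simp add: gateaux_deriv_snd_def)
qed

text \<open>
  The chain rule along the line \<open>t \<mapsto> w + t u\<close> reduces this to a function of one real variable,
  for which the remainder divided by \<open>\<bar>t\<bar>\<close> has the same norm as the quotient by \<open>t\<close> minus the
  derivative. This form also covers \<open>u = 0\<close>.
\<close>

lemma frechet_derivative_directional_limit:
  fixes f :: "'b::real_normed_vector \<Rightarrow> 'c::real_normed_vector"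
  assumes "f differentiable (at w)"
  shows "((\<lambda>t::real. (f (w + t *\<^sub>R u) - f w) /\<^sub>R t)
           \<longlongrightarrow> frechet_derivative f (at w) u) (at 0)"
proof -
  let ?D = "frechet_derivative f (at w)"
  have D: "(f has_derivative ?D) (at w)"
    using assms by (simp add: frechet_derivative_works)
  have "((\<lambda>t::real. w + t *\<^sub>R u) has_derivative (\<lambda>t. t *\<^sub>R u)) (at 0)"
    by (auto intro!: derivative_eq_intros)
  then have "((\<lambda>t::real. f (w + t *\<^sub>R u)) has_derivative (\<lambda>t. ?D (t *\<^sub>R u))) (at 0)"
    by (rule has_derivative_compose) (use D in simp)
  moreover have "?D (t *\<^sub>R u) = t *\<^sub>R ?D u" for t
    using has_derivative_linear[OF D] by (rule linear_scale)
  ultimately have lim: "((\<lambda>t::real. norm (f (w + t *\<^sub>R u) - f w - t *\<^sub>R ?D u) / norm t) \<longlongrightarrow> 0) (at 0)"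
    by (simp add: has_derivative_at)
  have "norm (f (w + t *\<^sub>R u) - f w - t *\<^sub>R ?D u) / norm t
      = norm ((f (w + t *\<^sub>R u) - f w) /\<^sub>R t - ?D u)" if "t \<noteq> 0" for t :: real
  proof -
    have "(f (w + t *\<^sub>R u) - f w) /\<^sub>R t - ?D u
        = (f (w + t *\<^sub>R u) - f w - t *\<^sub>R ?D u) /\<^sub>R t"
      using that by (simp add: scaleR_diff_right)
    then show ?thesis
      by (simp add: divide_inverse_commute)
  qed
  then have "\<forall>\<^sub>F t::real in at 0. norm (f (w + t *\<^sub>R u) - f w - t *\<^sub>R ?D u) / norm t
      = norm ((f (w + t *\<^sub>R u) - f w) /\<^sub>R t - ?D u)"
    by (auto simp: eventually_at_filter)
  with lim have "((\<lambda>t::real. norm ((f (w + t *\<^sub>R u) - f w) /\<^sub>R t - ?D u)) \<longlongrightarrow> 0) (at 0)"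
    by (rule Lim_transform_eventually)
  then show ?thesis
    by (rule LIM_zero_cancel[OF tendsto_norm_zero_cancel])
qed

theorem corollary8p3:
  fixes C A :: "'a::banach set" and K B :: "'b::banach set" and M :: "'c::banach set"
    and F :: "'a \<times> 'b \<Rightarrow> 'c" and x :: 'a
  assumes "pointed_closed_convex_cone C"
    and "pointed_closed_convex_cone K"
    and "pointed_closed_convex_cone M"
    and "A \<noteq> {}" "convex A" "open A"
    and "B \<noteq> {}" "convex B" "open B"
    and "x \<in> A"
  shows
    "((\<forall>a\<in>A. \<forall>b\<in>B. gateaux_differentiable_fst F a b \<and> gateaux_differentiable_snd F a b) \<longrightarrow>
       (order_increasing_snd K M B F x \<longrightarrow>
          (\<forall>w\<in>B. \<forall>u\<in>K - {0}. 0 \<preceq>\<^bsub>M\<^esub> gateaux_deriv_snd F x w u)) \<and>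
       (order_decreasing_snd K M B F x \<longrightarrow>
          (\<forall>w\<in>B. \<forall>u\<in>K - {0}. gateaux_deriv_snd F x w u \<preceq>\<^bsub>M\<^esub> 0)))
   \<and> ((\<forall>a\<in>A. \<forall>b\<in>B. frechet_differentiable_fst F a b \<and> frechet_differentiable_snd F a b) \<longrightarrow>
       (order_increasing_snd K M B F x \<longrightarrow>
          (\<forall>w\<in>B. \<forall>u\<in>K - {0}. 0 \<preceq>\<^bsub>M\<^esub> frechet_deriv_snd F x w u)) \<and>
       (order_decreasing_snd K M B F x \<longrightarrow>
          (\<forall>w\<in>B. \<forall>u\<in>K - {0}. frechet_deriv_snd F x w u \<preceq>\<^bsub>M\<^esub> 0)))"
proof -
  have cones: "cone K" "cone M" "closed M"
    using assms by (auto simp: pointed_closed_convex_cone_def)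
  have up: "0 \<preceq>\<^bsub>M\<^esub> l"
    if "order_increasing_snd K M B F x" "w \<in> B" "u \<in> K - {0}"
      and "((\<lambda>t::real. (F (x, w + t *\<^sub>R u) - F (x, w)) /\<^sub>R t) \<longlongrightarrow> l) (at 0)"
    for w u l
    using directional_derivative_mem_cone[OF cones \<open>open B\<close>, of w u "\<lambda>y. F (x, y)" l] that
    by (auto simp: order_increasing_snd_def cone_le_def)
  have down: "l \<preceq>\<^bsub>M\<^esub> 0"
    if "order_decreasing_snd K M B F x" "w \<in> B" "u \<in> K - {0}"
      and "((\<lambda>t::real. (F (x, w + t *\<^sub>R u) - F (x, w)) /\<^sub>R t) \<longlongrightarrow> l) (at 0)"
    for w u l
    using directional_derivative_neg_mem_cone[OF cones \<open>open B\<close>, of w u "\<lambda>y. F (x, y)" l] that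
    by (auto simp: order_decreasing_snd_def cone_le_def)
  have gateaux: "((\<lambda>t::real. (F (x, w + t *\<^sub>R u) - F (x, w)) /\<^sub>R t)
                   \<longlongrightarrow> gateaux_deriv_snd F x w u) (at 0)"
    if "\<forall>a\<in>A. \<forall>b\<in>B. gateaux_differentiable_fst F a b \<and> gateaux_differentiable_snd F a b"
      and "w \<in> B" "u \<in> K - {0}" for w u
    using that \<open>x \<in> A\<close> by (intro gateaux_deriv_snd_limit) auto
  have frechet: "((\<lambda>t::real. (F (x, w + t *\<^sub>R u) - F (x, w)) /\<^sub>R t)
                   \<longlongrightarrow> frechet_deriv_snd F x w u) (at 0)"
    if "\<forall>a\<in>A. \<forall>b\<in>B. frechet_differentiable_fst F a b \<and> frechet_differentiable_snd F a b"
      and "w \<in> B" for w u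
    using that \<open>x \<in> A\<close> frechet_derivative_directional_limit[of "\<lambda>y. F (x, y)" w u]
    by (auto simp: frechet_deriv_snd_def frechet_differentiable_snd_def)
  show ?thesis
    using up[OF _ _ _ gateaux] down[OF _ _ _ gateaux] up[OF _ _ _ frechet] down[OF _ _ _ frechet]
    by blast
qed

end
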